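(* Let $\psi$ be an entire function and let $\varphi(z)=az+b$, where $a,b\in\mathbb{C}$ and $0<|a|<1$. Let $n$ be a non-negative integer and $m$ a positive integer. Assume that the weighted composition operator $C_{\psi,\varphi}$ is bounded on the Fock space $\mathcal{F}^2$. Let $p=\frac{b}{1-a}$ be the fixed point of $\varphi$ and suppose that $\psi(p)=0$. Let $q(z)=e^{\overline{p}(a-1)z}\psi(z+p)$, which belongs to $\mathcal{F}^2$, and write $q(z)=\sum_{j=0}^{\infty}\widehat{q}_j\frac{z^j}{\sqrt{j!}}$. Then the numerical range $W(C_{\psi,\varphi})$ contains the closed disk with center $0$ and radius $$\frac{1}{2}\left|\widehat{q}_{m}a^{n}\frac{\sqrt{(n+m)!}}{\sqrt{m!\,n!}}\right|.$$
   Context: The Fock space $\mathcal{F}^2$ is the Hilbert space of all entire functions $f:\mathbb{C}\to\mathbb{C}$ that are square integrable with respect to $d\mu(z)=\pi^{-1}e^{-|z|^2}\,dA(z)$, where $dA$ is Lebesgue measure on $\mathbb{C}$, with inner product $\langle f,g\rangle=\int_{\mathbb{C}}f\overline{g}\,d\mu$. The functions $z^j/\sqrt{j!}$, $j\ge 0$, form an orthonormal basis. For entire functions $\psi,\varphi$, the weighted composition operator is $C_{\psi,\varphi}h=\psi\cdot(h\circ\varphi)$. The numerical range of a bounded operator $T$ on a Hilbert space is $W(T)=\{\langle Tf,f\rangle:\|f\|=1\}$. *)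

theory Defs
  imports "HOL-Complex_Analysis.Complex_Analysis"
begin

definition fock_measure :: "complex measure" where
  "fock_measure = density lborel (\<lambda>z. ennreal (exp (- ((norm z)\<^sup>2)) / pi))"

definition fock_space :: "(complex \<Rightarrow> complex) set" where
  "fock_space = {f. f holomorphic_on UNIV \<and> integrable fock_measure (\<lambda>z. (norm (f z))\<^sup>2)}"

definition fock_inner :: "(complex \<Rightarrow> complex) \<Rightarrow> (complex \<Rightarrow> complex) \<Rightarrow> complex" where
  "fock_inner f g = (\<integral>z. f z * cnj (g z) \<partial>fock_measure)"

definition fock_norm :: "(complex \<Rightarrow> complex) \<Rightarrow> real" where
  "fock_norm f = sqrt (Re (fock_inner f f))"

definition weighted_comp ::
  "(complex \<Rightarrow> complex) \<Rightarrow> (complex \<Rightarrow> complex) \<Rightarrow> (complex \<Rightarrow> complex) \<Rightarrow> complex \<Rightarrow> complex" where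
  "weighted_comp \<psi> \<phi> h = (\<lambda>z. \<psi> z * h (\<phi> z))"

(* Operators on the Fock space are represented by maps on all functions, of which only the
   values on fock_space matter. Linearity is not part of this predicate; it is automatic for
   weighted composition operators. *)
definition fock_bounded :: "((complex \<Rightarrow> complex) \<Rightarrow> (complex \<Rightarrow> complex)) \<Rightarrow> bool" where
  "fock_bounded T \<longleftrightarrow>
     (\<forall>f\<in>fock_space. T f \<in> fock_space) \<and>
     (\<exists>K. \<forall>f\<in>fock_space. fock_norm (T f) \<le> K * fock_norm f)"

definition numerical_range :: "((complex \<Rightarrow> complex) \<Rightarrow> (complex \<Rightarrow> complex)) \<Rightarrow> complex set" where
  "numerical_range T = {fock_inner (T f) f | f. f \<in> fock_space \<and> fock_norm f = 1}"

end

theory Submission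
  imports Defs "HOL-Probability.Distributions" begin

text \<open>
  The Weyl unitary \<open>g \<mapsto> exp (cnj p * z - |p|\<^sup>2 / 2) * g (z - p)\<close> conjugates the operator to
  \<open>g \<mapsto> q(z) * g(a * z)\<close>, which has the same numerical range. With respect to the orthonormal
  vectors \<open>e\<^sub>k = z^k / sqrt (k!)\<close>, the compression of the latter operator to the span of \<open>e\<^sub>n\<close> and
  \<open>e\<^sub>n\<^sub>+\<^sub>m\<close> is a nilpotent \<open>2 \<times> 2\<close> matrix: it is lower triangular, and its diagonal vanishes
  because \<open>q(0) = \<psi>(p) = 0\<close>. The numerical range of such a matrix is the closed disk around \<open>0\<close>
  whose radius is half the modulus of the only nonzero entry.

  Orthogonality of the monomials comes from the rotation invariance of the Gaussian measure.
  Power series are integrated termwise over disks, where they converge uniformly, before the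
  radius tends to infinity.
\<close>

section \<open>Rotation invariance of planar Lebesgue measure\<close>

lemma measurable_Complex [measurable]:
  "(\<lambda>(x, y). Complex x y) \<in> borel_measurable (borel \<Otimes>\<^sub>M borel)"
  unfolding borel_prod split_beta complex_eq_iff Complex_eq
  by (intro borel_measurable_continuous_onI continuous_intros)

text \<open>This gives access to Fubini in the plane. Lebesgue measure is determined by its values
  on boxes, and a complex box corresponds to a product of two real intervals.\<close>

lemma lborel_complex_eq_distr:
  "(lborel :: complex measure) = distr (lborel \<Otimes>\<^sub>M lborel) borel (\<lambda>(x, y). Complex x y)"
proof (rule lborel_eqI)
  fix l u :: complex
  assume le: "\<And>b. b \<in> Basis \<Longrightarrow> l \<bullet> b \<le> u \<bullet> b"
  have Re: "Re l \<le> Re u" and Im: "Im l \<le> Im u"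
    using le[of 1] le[of \<i>] by (auto simp: Basis_complex_def inner_complex_def)
  have "(\<lambda>(x, y). Complex x y) -` box l u = box (Re l) (Re u) \<times> box (Im l) (Im u)"
    by (auto simp: box_def Basis_complex_def inner_complex_def)
  then have "emeasure (distr (lborel \<Otimes>\<^sub>M lborel) borel (\<lambda>(x, y). Complex x y)) (box l u) =
      emeasure (lborel \<Otimes>\<^sub>M lborel) (box (Re l) (Re u) \<times> box (Im l) (Im u))"
    using measurable_Complex by (subst emeasure_distr) (auto simp: space_pair_measure)
  also have "\<dots> = ennreal (\<Prod>b\<in>Basis. (u - l) \<bullet> b)"
    using Re Im by (simp add: lborel.emeasure_pair_measure_Times Basis_complex_def inner_complex_def
        ennreal_mult' box_real)
  finally show "emeasure (distr (lborel \<Otimes>\<^sub>M lborel) borel (\<lambda>(x, y). Complex x y)) (box l u) =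
      ennreal (\<Prod>b\<in>Basis. (u - l) \<bullet> b)" .
qed simp

text \<open>Both orders of integration are provided: a horizontal shear is treated in an inner
  x-integral, a vertical one in an inner y-integral.\<close>

lemma nn_integral_lborel_complex:
  assumes [measurable]: "f \<in> borel_measurable borel"
  shows "(\<integral>\<^sup>+z. f z \<partial>lborel) = (\<integral>\<^sup>+y. \<integral>\<^sup>+x. f (Complex x y) \<partial>lborel \<partial>lborel)"
    and "(\<integral>\<^sup>+z. f z \<partial>lborel) = (\<integral>\<^sup>+x. \<integral>\<^sup>+y. f (Complex x y) \<partial>lborel \<partial>lborel)"
proof -
  have f[measurable]: "(\<lambda>(x, y). f (Complex x y)) \<in> borel_measurable (borel \<Otimes>\<^sub>M borel)"
    using measurable_compose[OF measurable_Complex assms] by (simp add: split_beta)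
  have eq: "(\<integral>\<^sup>+z. f z \<partial>lborel) = (\<integral>\<^sup>+z. (\<lambda>(x, y). f (Complex x y)) z \<partial>(lborel \<Otimes>\<^sub>M lborel))"
    using measurable_Complex
    by (subst lborel_complex_eq_distr, subst nn_integral_distr) (simp_all add: case_prod_unfold)
  show "(\<integral>\<^sup>+z. f z \<partial>lborel) = (\<integral>\<^sup>+y. \<integral>\<^sup>+x. f (Complex x y) \<partial>lborel \<partial>lborel)"
    unfolding eq by (subst lborel_pair.nn_integral_snd[symmetric]) auto
  show "(\<integral>\<^sup>+z. f z \<partial>lborel) = (\<integral>\<^sup>+x. \<integral>\<^sup>+y. f (Complex x y) \<partial>lborel \<partial>lborel)"
    unfolding eq by (subst lborel.nn_integral_fst[symmetric]) auto
qed

lemma nn_integral_lborel_translate: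
  fixes f :: "'a::euclidean_space \<Rightarrow> ennreal"
  assumes [measurable]: "f \<in> borel_measurable borel"
  shows "(\<integral>\<^sup>+z. f (c + z) \<partial>lborel) = (\<integral>\<^sup>+z. f z \<partial>lborel)"
  by (subst lborel_distr_plus[of c, symmetric], subst nn_integral_distr) auto

text \<open>On each line parallel to its direction a shear is a translation, so the inner integral
  does not change.\<close>

lemma nn_integral_lborel_shear:
  fixes t :: real
  assumes [measurable]: "f \<in> borel_measurable borel"
  shows "(\<integral>\<^sup>+z. f (z + of_real (t * Im z)) \<partial>lborel) = (\<integral>\<^sup>+z. f z \<partial>lborel)"
    and "(\<integral>\<^sup>+z. f (z + \<i> * of_real (t * Re z)) \<partial>lborel) = (\<integral>\<^sup>+z. f z \<partial>lborel)"
proof -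
  have m: "(\<lambda>x. f (Complex x y)) \<in> borel_measurable borel" "(\<lambda>x. f (Complex y x)) \<in> borel_measurable borel" for y
    using measurable_compose[OF _ assms]
    by (auto simp: Complex_eq)
  have "(\<integral>\<^sup>+z. f (z + of_real (t * Im z)) \<partial>lborel) =
    (\<integral>\<^sup>+y. \<integral>\<^sup>+x. f (Complex (t * y + x) y) \<partial>lborel \<partial>lborel)"
    by (subst nn_integral_lborel_complex(1)) (auto simp: Complex_eq algebra_simps)
  also have "\<dots> = (\<integral>\<^sup>+z. f z \<partial>lborel)"
    by (simp add: nn_integral_lborel_translate[OF m(1)] nn_integral_lborel_complex(1))
  finally show "(\<integral>\<^sup>+z. f (z + of_real (t * Im z)) \<partial>lborel) = (\<integral>\<^sup>+z. f z \<partial>lborel)" .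
  have "(\<integral>\<^sup>+z. f (z + \<i> * of_real (t * Re z)) \<partial>lborel) =
    (\<integral>\<^sup>+x. \<integral>\<^sup>+y. f (Complex x (t * x + y)) \<partial>lborel \<partial>lborel)"
    by (subst nn_integral_lborel_complex(2)) (auto simp: Complex_eq algebra_simps)
  also have "\<dots> = (\<integral>\<^sup>+z. f z \<partial>lborel)"
    by (simp add: nn_integral_lborel_translate[OF m(2)] nn_integral_lborel_complex(2))
  finally show "(\<integral>\<^sup>+z. f (z + \<i> * of_real (t * Re z)) \<partial>lborel) = (\<integral>\<^sup>+z. f z \<partial>lborel)" .
qed

lemma nn_integral_lborel_rotate:
  fixes u :: complex
  assumes u: "norm u = 1" and [measurable]: "f \<in> borel_measurable borel"
  shows "(\<integral>\<^sup>+z. f (u * z) \<partial>lborel) = (\<integral>\<^sup>+z. f z \<partial>lborel)"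
proof -
  have *: "(\<integral>\<^sup>+z. g (v * z) \<partial>lborel) = (\<integral>\<^sup>+z. g z \<partial>lborel)"
    if v: "norm v = 1" "v \<noteq> -1" and [measurable]: "g \<in> borel_measurable borel"
    for v and g :: "complex \<Rightarrow> ennreal"
  proof -
    txt \<open>A rotation by an angle other than \<open>\<pi>\<close> is a product of three shears; the first and the
      last have slope \<open>- tan (angle / 2)\<close>.\<close>
    have sq: "(Re v)\<^sup>2 + (Im v)\<^sup>2 = 1"
      using v(1) by (simp add: cmod_def)
    have ne: "1 + Re v \<noteq> 0"
    proof
      assume "1 + Re v = 0"
      then have "Re v = -1" by simp
      with sq v(2) show False by (auto simp: complex_eq_iff)
    qed
    define t where "t = - Im v / (1 + Re v)"
    define s where "s = Im v"
    \<comment> \<open>The product of the three shears has diagonal entries 1 + s t, upper right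
      entry 2 t + s t^2 and lower left entry s. The next two identities turn it into the matrix of
      multiplication by \<open>v\<close>.\<close>
    have s1: "1 + s * t = Re v"
      using sq ne unfolding t_def s_def by (simp add: field_simps power2_eq_square)
    have s2: "2 * t + s * t\<^sup>2 = - Im v"
    proof -
      have "t * (1 + Re v) = - Im v" using ne by (simp add: t_def)
      then have "t * (1 + (1 + s * t)) = - Im v" using s1 by simp
      then show ?thesis by (simp add: algebra_simps power2_eq_square)
    qed
    define S1 where "S1 = (\<lambda>z. z + complex_of_real (t * Im z))"
    define S2 where "S2 = (\<lambda>z. z + \<i> * complex_of_real (s * Re z))"
    have [measurable]: "S1 \<in> borel_measurable borel" "S2 \<in> borel_measurable borel"
      unfolding S1_def S2_def by measurable
    have S1: "(\<integral>\<^sup>+z. f (S1 z) \<partial>lborel) = (\<integral>\<^sup>+z. f z \<partial>lborel)"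
      and S2: "(\<integral>\<^sup>+z. f (S2 z) \<partial>lborel) = (\<integral>\<^sup>+z. f z \<partial>lborel)"
      if "f \<in> borel_measurable borel" for f :: "complex \<Rightarrow> ennreal"
      unfolding S1_def S2_def using that by (rule nn_integral_lborel_shear)+
    have "v * z = S1 (S2 (S1 z))" for z
    proof -
      have "Re (S1 (S2 (S1 z))) = (1 + s * t) * Re z + (2 * t + s * t\<^sup>2) * Im z"
           "Im (S1 (S2 (S1 z))) = s * Re z + (1 + s * t) * Im z"
        by (simp_all add: S1_def S2_def algebra_simps power2_eq_square)
      then show ?thesis
        unfolding s1 s2 by (simp add: complex_eq_iff s_def)
    qed
    then have "(\<integral>\<^sup>+z. g (v * z) \<partial>lborel) = (\<integral>\<^sup>+z. g (S1 (S2 (S1 z))) \<partial>lborel)"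
      by simp
    also have "\<dots> = (\<integral>\<^sup>+z. g (S1 (S2 z)) \<partial>lborel)"
      by (rule S1) measurable
    also have "\<dots> = (\<integral>\<^sup>+z. g (S1 z) \<partial>lborel)"
      by (rule S2) measurable
    also have "\<dots> = (\<integral>\<^sup>+z. g z \<partial>lborel)"
      by (rule S1) measurable
    finally show ?thesis .
  qed
  show ?thesis
  proof (cases "u = -1")
    case True
    \<comment> \<open>For a half turn the denominator of the slope vanishes, so it is split into two
      quarter turns.\<close>
    have "(\<integral>\<^sup>+z. f (u * z) \<partial>lborel) = (\<integral>\<^sup>+z. f (\<i> * (\<i> * z)) \<partial>lborel)"
      by (simp add: True mult.assoc[symmetric])
    also have "\<dots> = (\<integral>\<^sup>+z. f (\<i> * z) \<partial>lborel)"
      by (rule *) (auto simp: complex_eq_iff)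
    also have "\<dots> = (\<integral>\<^sup>+z. f z \<partial>lborel)"
      by (rule *) (auto simp: complex_eq_iff)
    finally show ?thesis .
  qed (use * u in auto)
qed

section \<open>The Gaussian measure\<close>

text \<open>A substitute for polar coordinates. The disk of points with |z|^2 at most a has area pi
  a, and the half-lines \<open>{..a}\<close> form an intersection-stable generator of the Borel
  sets.\<close>

lemma distr_lborel_norm_power2:
  "distr lborel borel (\<lambda>z::complex. (norm z)\<^sup>2) =
     density lborel (\<lambda>s. ennreal pi * indicator {0..} s)" (is "?M = ?N")
proof (rule measure_eqI_generator_eq[where E = "range atMost" and A = "\<lambda>i. {..real i}" and \<Omega> = UNIV])
  have M: "emeasure ?M {..a} = (if a < 0 then 0 else ennreal (pi * a))" for a :: real
  proof -
    have "(\<lambda>z::complex. (norm z)\<^sup>2) -` {..a} = (if a < 0 then {} else cball 0 (sqrt a))"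
    proof -
      have "(norm z)\<^sup>2 \<le> a \<longleftrightarrow> a \<ge> 0 \<and> norm z \<le> sqrt a" for z :: complex
        using sqrt_ge_absD[of "norm z" a] real_le_rsqrt[of "norm z" a] zero_le_power2[of "norm z"]
        by (metis abs_norm_cancel order_trans)
      then show ?thesis by auto
    qed
    then show ?thesis
      by (subst emeasure_distr) (auto simp: emeasure_cball unit_ball_vol_2 mult.commute)
  qed
  have N: "emeasure ?N {..a} = (if a < 0 then 0 else ennreal (pi * a))" for a :: real
  proof -
    have "emeasure ?N {..a} = (\<integral>\<^sup>+s. ennreal pi * indicator {0..a} s \<partial>lborel)"
      by (subst emeasure_density) (auto intro!: nn_integral_cong simp: indicator_def)
    also have "\<dots> = (if a < 0 then 0 else ennreal (pi * a))"
      by (simp add: nn_integral_cmult ennreal_mult')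
    finally show ?thesis .
  qed
  show "Int_stable (range atMost :: real set set)"
    by (auto simp: Int_stable_def)
  show "emeasure ?M X = emeasure ?N X" if "X \<in> range atMost" for X
    using that M N by auto
  show "sets ?M = sigma_sets UNIV (range atMost)" "sets ?N = sigma_sets UNIV (range atMost)"
    by (simp_all add: borel_eq_atMost)
  show "emeasure ?M {..real i} \<noteq> \<infinity>" for i
    using M by simp
  show "(\<Union>i. {..real i}) = UNIV"
    using real_arch_simple by auto
qed auto

lemma nn_integral_fock_measure:
  assumes [measurable]: "f \<in> borel_measurable borel"
  shows "(\<integral>\<^sup>+z. f z \<partial>fock_measure) = (\<integral>\<^sup>+z. ennreal (exp (- ((norm z)\<^sup>2)) / pi) * f z \<partial>lborel)"
  unfolding fock_measure_def by (subst nn_integral_density) auto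

text \<open>With s = |z|^2 the factor pi cancels and Euler's integral of s^k exp(-s) over the
  half-line remains.\<close>

lemma nn_integral_fock_moment:
  "(\<integral>\<^sup>+z. ennreal (norm z ^ (2 * k)) \<partial>fock_measure) = ennreal (fact k)"
proof -
  have "(\<integral>\<^sup>+z. ennreal (norm z ^ (2 * k)) \<partial>fock_measure) =
      (\<integral>\<^sup>+z. ennreal (exp (- (norm (z::complex))\<^sup>2) / pi * ((norm z)\<^sup>2) ^ k) \<partial>lborel)"
    by (subst nn_integral_fock_measure) (auto simp: ennreal_mult'[symmetric] power_mult)
  also have "\<dots> = (\<integral>\<^sup>+s. ennreal (exp (- s) / pi * s ^ k)
      \<partial>distr lborel borel (\<lambda>z::complex. (norm z)\<^sup>2))"
    by (subst nn_integral_distr) auto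
  also have "\<dots> = (\<integral>\<^sup>+s. ennreal (s ^ k * exp (- s)) * indicator {0..} s \<partial>lborel)"
    unfolding distr_lborel_norm_power2
    by (subst nn_integral_density)
       (auto intro!: nn_integral_cong simp: indicator_def ennreal_mult'[symmetric])
  also have "\<dots> = ennreal (fact k)"
    by (subst nn_intergal_power_times_exp_Ici) simp
  finally show ?thesis .
qed

text \<open>The density depends on the modulus only, so the measure inherits rotation invariance
  from Lebesgue measure.\<close>

lemma distr_fock_measure_rotate:
  assumes "norm u = 1"
  shows "distr fock_measure borel ((*) u) = fock_measure"
proof (rule measure_eqI)
  fix A assume "A \<in> sets (distr fock_measure borel ((*) u))"
  then have A[measurable]: "A \<in> sets borel" by simp
  have [measurable]: "(*) u \<in> measurable fock_measure borel"
    by (simp add: fock_measure_def)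
  have "emeasure (distr fock_measure borel ((*) u)) A = (\<integral>\<^sup>+z. indicator A z \<partial>distr fock_measure borel ((*) u))"
    by simp
  also have "\<dots> = (\<integral>\<^sup>+z. indicator A (u * z) \<partial>fock_measure)"
    by (subst nn_integral_distr) auto
  also have "\<dots> = (\<integral>\<^sup>+z. ennreal (exp (- ((norm (u * z))\<^sup>2)) / pi) * indicator A (u * z) \<partial>lborel)"
    using assms by (subst nn_integral_fock_measure) (auto simp: norm_mult)
  also have "\<dots> = (\<integral>\<^sup>+z. ennreal (exp (- ((norm z)\<^sup>2)) / pi) * indicator A z \<partial>lborel)"
    using assms by (subst nn_integral_lborel_rotate) auto
  also have "\<dots> = (\<integral>\<^sup>+z. indicator A z \<partial>fock_measure)"
    by (subst nn_integral_fock_measure) auto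
  also have "\<dots> = emeasure fock_measure A"
    by (simp add: fock_measure_def)
  finally show "emeasure (distr fock_measure borel ((*) u)) A = emeasure fock_measure A" .
qed (simp add: fock_measure_def)


lemma sets_fock_measure [measurable_cong, simp]: "sets fock_measure = sets borel"
  by (simp add: fock_measure_def)

lemma space_fock_measure [simp]: "space fock_measure = UNIV"
  by (simp add: fock_measure_def)

lemma integral_fock_measure_rotate:
  fixes f :: "complex \<Rightarrow> 'a::{banach, second_countable_topology}"
  assumes "norm u = 1" "f \<in> borel_measurable borel"
  shows "(\<integral>z. f (u * z) \<partial>fock_measure) = (\<integral>z. f z \<partial>fock_measure)"
proof -
  have "(\<integral>z. f z \<partial>fock_measure) = (\<integral>z. f z \<partial>distr fock_measure borel ((*) u))"
    by (simp add: distr_fock_measure_rotate assms(1))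
  also have "\<dots> = (\<integral>z. f (u * z) \<partial>fock_measure)"
    using assms(2) by (subst integral_distr) auto
  finally show ?thesis by simp
qed

lemma prob_space_fock_measure: "prob_space fock_measure"
  using nn_integral_fock_moment[of 0] by (intro prob_spaceI) simp

lemma integrable_fock_moment: "integrable fock_measure (\<lambda>z. norm z ^ (2 * k))"
  by (rule integrableI_bounded) (auto simp: nn_integral_fock_moment norm_power)

lemma integral_fock_moment: "(\<integral>z. norm z ^ (2 * k) \<partial>fock_measure) = fact k"
  by (subst integral_eq_nn_integral) (auto simp: nn_integral_fock_moment)

section \<open>Gaussian integrals over disks\<close>

lemma integrable_fock_measure_disc:
  fixes f :: "complex \<Rightarrow> 'a::{banach, second_countable_topology}"
  assumes [measurable]: "f \<in> borel_measurable borel" and "\<And>z. norm z \<le> R \<Longrightarrow> norm (f z) \<le> B"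
  shows "integrable fock_measure (\<lambda>z. indicator (cball 0 R) z *\<^sub>R f z)"
proof (rule Bochner_Integration.integrable_bound)
  interpret prob_space fock_measure by (rule prob_space_fock_measure)
  show "integrable fock_measure (\<lambda>z. \<bar>B\<bar>)" by simp
  show "AE z in fock_measure. norm (indicator (cball 0 R) z *\<^sub>R f z) \<le> norm \<bar>B\<bar>"
    using assms(2) by (intro always_eventually) (fastforce simp: indicator_def)
qed (intro borel_measurable_scaleR borel_measurable_indicator, auto)

text \<open>Rotation by \<open>u\<close> preserves the disk and the measure but multiplies the
  integrand by a constant. If this constant is not 1, the integral must vanish.\<close>

lemma integral_fock_disc_monomial:
  assumes "j \<noteq> k"
  shows "(\<integral>z. indicator (cball 0 R) z *\<^sub>R (z ^ j * cnj z ^ k) \<partial>fock_measure) = 0"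
proof -
  have [measurable]: "cnj \<in> borel_measurable borel"
    by (intro borel_measurable_continuous_onI continuous_intros)
  define I where "I = (\<integral>z. indicator (cball 0 R) z *\<^sub>R (z ^ j * cnj z ^ k) \<partial>fock_measure)"
  \<comment> \<open>This angle makes the constant equal to \<open>cis 1\<close>, whose imaginary
    part sin 1 is positive. The difference is taken in the reals since \<open>j\<close> may be
    smaller than \<open>k\<close>.\<close>
  define u where "u = cis (1 / (real j - real k))"
  have u: "u ^ j * cnj u ^ k = cis 1"
  proof -
    have "u ^ j * cnj u ^ k = cis ((real j - real k) * (1 / (real j - real k)))"
      by (simp add: u_def cis_cnj Complex.DeMoivre cis_mult flip: diff_divide_distrib)
    then show ?thesis using assms by simp
  qed
  have "I = (\<integral>z. indicator (cball 0 R) (u * z) *\<^sub>R ((u * z) ^ j * cnj (u * z) ^ k) \<partial>fock_measure)"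
    unfolding I_def
    by (rule integral_fock_measure_rotate[symmetric])
       (simp add: u_def, intro borel_measurable_scaleR borel_measurable_indicator, simp_all)
  also have "\<dots> = (\<integral>z. cis 1 * (indicator (cball 0 R) z *\<^sub>R (z ^ j * cnj z ^ k)) \<partial>fock_measure)"
  proof (rule Bochner_Integration.integral_cong)
    fix z
    have "indicator (cball 0 R) (u * z) = (indicator (cball 0 R) z :: real)"
      by (auto simp: indicator_def norm_mult u_def)
    moreover have "(u * z) ^ j * cnj (u * z) ^ k = cis 1 * (z ^ j * cnj z ^ k)"
      using u by (simp add: power_mult_distrib algebra_simps)
    ultimately show "indicator (cball 0 R) (u * z) *\<^sub>R ((u * z) ^ j * cnj (u * z) ^ k) =
        cis 1 * (indicator (cball 0 R) z *\<^sub>R (z ^ j * cnj z ^ k))" by simp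
  qed simp
  also have "\<dots> = cis 1 * I" unfolding I_def by (rule integral_mult_right_zero)
  finally have "(1 - cis 1) * I = 0" by (simp add: algebra_simps)
  moreover have "cis 1 \<noteq> 1"
    using sin_gt_zero_02[of 1] by (auto simp: complex_eq_iff)
  ultimately show ?thesis by (auto simp: I_def)
qed

section \<open>Inner products with monomials\<close>

lemma holomorphic_borel_measurable:
  assumes "f holomorphic_on UNIV"
  shows "f \<in> borel_measurable borel"
  using assms by (intro borel_measurable_continuous_onI holomorphic_on_imp_continuous_on)

lemma power_mult_cnj_power: "z ^ k * cnj z ^ k = of_real (norm z ^ (2 * k))"
  by (simp only: power_mult of_real_power[of "(norm z)\<^sup>2"] complex_norm_square power_mult_distrib)

text \<open>On a disk the terms are dominated by a convergent numerical series, so sum and integral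
  may be interchanged; then only the term \<open>j = k\<close> survives.\<close>

lemma integral_fock_disc_power_series:
  assumes h: "\<And>z. (\<lambda>j. c j * z ^ j) sums h z"
  shows "(\<integral>z. indicator (cball 0 R) z *\<^sub>R (h z * cnj z ^ k) \<partial>fock_measure) =
    c k * of_real (\<integral>z. indicator (cball 0 R) z *\<^sub>R norm z ^ (2 * k) \<partial>fock_measure)"
proof (cases "R \<ge> 0")
  case True
  define F where "F = (\<lambda>j z. indicator (cball 0 R) z *\<^sub>R (c j * z ^ j * cnj z ^ k))"
  interpret prob_space fock_measure by (rule prob_space_fock_measure)
  have le: "norm (F j z) \<le> norm (c j) * R ^ j * R ^ k" for j z
    using True by (auto simp: F_def indicator_def norm_mult norm_power intro!: mult_mono power_mono)
  have [measurable]: "cnj \<in> borel_measurable borel"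
    by (intro borel_measurable_continuous_onI continuous_intros)
  have intF: "integrable fock_measure (F j)" for j
    unfolding F_def
    by (rule integrable_fock_measure_disc[where B = "norm (c j) * R ^ j * R ^ k"])
       (use True in \<open>auto simp: norm_mult norm_power intro!: mult_mono power_mono\<close>)
  have summ: "summable (\<lambda>j. norm (c j) * R ^ j * R ^ k)"
  proof -
    \<comment> \<open>Convergence at the larger radius \<open>R + 1\<close> yields absolute
      convergence at \<open>R\<close>.\<close>
    have "summable (\<lambda>j. c j * of_real (R + 1) ^ j)" using h sums_summable by blast
    then have "summable (\<lambda>j. norm (c j * of_real R ^ j))"
      by (rule powser_insidea) (use True in simp)
    then show ?thesis using True by (intro summable_mult2) (simp add: norm_mult norm_power)
  qed
  have norm_int: "norm (\<integral>z. norm (F j z) \<partial>fock_measure) \<le> norm (c j) * R ^ j * R ^ k" for j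
  proof -
    have "(\<integral>z. norm (F j z) \<partial>fock_measure) \<le> (\<integral>z. norm (c j) * R ^ j * R ^ k \<partial>fock_measure)"
      using le intF by (intro integral_mono) auto
    then show ?thesis using prob_space by simp
  qed
  have "(\<lambda>j. \<integral>z. F j z \<partial>fock_measure) sums (\<integral>z. (\<Sum>j. F j z) \<partial>fock_measure)"
  proof (rule sums_integral[OF intF])
    show "AE z in fock_measure. summable (\<lambda>j. norm (F j z))"
      using le by (intro always_eventually allI summable_comparison_test'[OF summ]) auto
    show "summable (\<lambda>j. \<integral>z. norm (F j z) \<partial>fock_measure)"
      using norm_int by (intro summable_comparison_test'[OF summ]) auto
  qed
  moreover have "(\<integral>z. F j z \<partial>fock_measure) =
     (if j = k then c k * of_real (\<integral>z. indicator (cball 0 R) z *\<^sub>R norm z ^ (2 * k) \<partial>fock_measure) else 0)" for j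
  proof (cases "j = k")
    case True
    have "F k = (\<lambda>z. c k * of_real (indicator (cball 0 R) z *\<^sub>R norm z ^ (2 * k)))"
      by (auto simp: F_def indicator_def power_mult_cnj_power mult.assoc)
    then show ?thesis using True
      by (simp only: integral_mult_right_zero integral_complex_of_real if_True refl)
  next
    case False
    have "F j = (\<lambda>z. c j * (indicator (cball 0 R) z *\<^sub>R (z ^ j * cnj z ^ k)))"
      by (auto simp: F_def)
    then show ?thesis using False
      by (simp only: integral_mult_right_zero integral_fock_disc_monomial[OF False] if_False mult_zero_right)
  qed
  ultimately have "(\<integral>z. (\<Sum>j. F j z) \<partial>fock_measure) =
      c k * of_real (\<integral>z. indicator (cball 0 R) z *\<^sub>R norm z ^ (2 * k) \<partial>fock_measure)"
    using sums_unique2[OF _ sums_single[of k "\<lambda>_. c k * of_real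
      (\<integral>z. indicator (cball 0 R) z *\<^sub>R norm z ^ (2 * k) \<partial>fock_measure)"]] by simp
  moreover have "(\<Sum>j. F j z) = indicator (cball 0 R) z *\<^sub>R (h z * cnj z ^ k)" for z
    unfolding F_def by (intro sums_unique[symmetric] sums_scaleR_right sums_mult2 h)
  ultimately show ?thesis by simp
qed simp

lemma tendsto_integral_fock_disc:
  fixes f :: "complex \<Rightarrow> 'a::{banach, second_countable_topology}"
  assumes "integrable fock_measure f"
  shows "(\<lambda>N. \<integral>z. indicator (cball 0 (real N)) z *\<^sub>R f z \<partial>fock_measure)
     \<longlonglongrightarrow> (\<integral>z. f z \<partial>fock_measure)"
proof (rule integral_dominated_convergence[where w = "\<lambda>z. norm (f z)"])
  have [measurable]: "f \<in> borel_measurable borel"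
    using borel_measurable_integrable[OF assms] by simp
  show "f \<in> borel_measurable fock_measure" by simp
  show "(\<lambda>z. indicator (cball 0 (real N)) z *\<^sub>R f z) \<in> borel_measurable fock_measure" for N
    by (intro borel_measurable_scaleR borel_measurable_indicator) auto
  \<comment> \<open>Once N reaches |z| the point lies in the disk, so the sequence is eventually
    constant.\<close>
  have "\<forall>\<^sub>F N in sequentially. indicator (cball 0 (real N)) z *\<^sub>R f z = f z" for z
    using eventually_ge_at_top[of "nat \<lceil>norm z\<rceil>"]
    by (rule eventually_mono) (simp add: indicator_def nat_le_iff ceiling_le_iff)
  then show "AE z in fock_measure. (\<lambda>N. indicator (cball 0 (real N)) z *\<^sub>R f z) \<longlonglongrightarrow> f z"
    by (simp add: tendsto_eventually)
  show "AE z in fock_measure. norm (indicator (cball 0 (real N)) z *\<^sub>R f z) \<le> norm (f z)" for N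
    by (simp add: indicator_def)
  show "integrable fock_measure (\<lambda>z. norm (f z))"
    using assms by simp
qed

lemma integrable_mult_cnj:
  assumes [measurable]: "f \<in> borel_measurable M" "g \<in> borel_measurable M"
    and "integrable M (\<lambda>z. (norm (f z))\<^sup>2)" "integrable M (\<lambda>z. (norm (g z))\<^sup>2)"
  shows "integrable M (\<lambda>z. f z * cnj (g z))"
proof (rule Bochner_Integration.integrable_bound)
  have [measurable]: "cnj \<in> borel_measurable borel"
    by (intro borel_measurable_continuous_onI continuous_intros)
  show "(\<lambda>z. f z * cnj (g z)) \<in> borel_measurable M" by measurable
  show "integrable M (\<lambda>z. (norm (f z))\<^sup>2 + (norm (g z))\<^sup>2)" using assms by simp
  have "norm (f z * cnj (g z)) \<le> (norm (f z))\<^sup>2 + (norm (g z))\<^sup>2" for z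
  proof -
    \<comment> \<open>The right-hand side expands to twice the difference of the two sides of the
      claim.\<close>
    have "0 \<le> (norm (f z) - norm (g z))\<^sup>2 + ((norm (f z))\<^sup>2 + (norm (g z))\<^sup>2)" by simp
    then show ?thesis by (simp add: norm_mult power2_eq_square algebra_simps)
  qed
  then show "AE z in M. norm (f z * cnj (g z)) \<le> norm ((norm (f z))\<^sup>2 + (norm (g z))\<^sup>2)"
    by simp
qed

lemma integrable_fock_inner:
  assumes "f \<in> fock_space" "g \<in> fock_space"
  shows "integrable fock_measure (\<lambda>z. f z * cnj (g z))"
proof (rule integrable_mult_cnj)
  have "f \<in> borel_measurable borel" "g \<in> borel_measurable borel"
    using assms by (simp_all add: fock_space_def holomorphic_borel_measurable)
  then show "f \<in> borel_measurable fock_measure" "g \<in> borel_measurable fock_measure"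
    by simp_all
qed (use assms in \<open>simp_all add: fock_space_def\<close>)

lemma power_in_fock_space: "(\<lambda>z. c * z ^ k) \<in> fock_space"
proof -
  have "(norm (c * z ^ k))\<^sup>2 = (norm c)\<^sup>2 * norm z ^ (2 * k)" for z
    by (simp only: norm_mult norm_power power_mult_distrib power_even_eq)
  then show ?thesis
    using integrable_fock_moment[of k] by (auto simp: fock_space_def intro!: holomorphic_intros)
qed

text \<open>Pairing with a monomial reads off a Taylor coefficient. Over the disk of radius N the
  integral is \<open>c k\<close> times a truncated moment, and as N grows the moment tends to
  k!.\<close>

lemma fock_inner_power:
  assumes "f \<in> fock_space" and h: "\<And>z. (\<lambda>j. c j * z ^ j) sums f z"
  shows "fock_inner f (\<lambda>z. z ^ k) = c k * fact k"
proof -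
  have 1: "(\<lambda>N. \<integral>z. indicator (cball 0 (real N)) z *\<^sub>R (f z * cnj z ^ k) \<partial>fock_measure)
      \<longlonglongrightarrow> fock_inner f (\<lambda>z. z ^ k)"
    using tendsto_integral_fock_disc[OF integrable_fock_inner[OF assms(1) power_in_fock_space[of 1 k]]]
    by (simp add: fock_inner_def)
  have 2: "(\<lambda>N. \<integral>z. indicator (cball 0 (real N)) z *\<^sub>R (f z * cnj z ^ k) \<partial>fock_measure)
      \<longlonglongrightarrow> c k * of_real (fact k)"
    unfolding integral_fock_disc_power_series[OF h]
    using tendsto_integral_fock_disc[OF integrable_fock_moment[of k]]
    by (intro tendsto_intros) (simp add: integral_fock_moment)
  from LIMSEQ_unique[OF 1 2] show ?thesis by simp
qed


lemma fock_space_add: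
  assumes "f \<in> fock_space" "g \<in> fock_space"
  shows "(\<lambda>z. f z + g z) \<in> fock_space"
proof -
  have hol: "f holomorphic_on UNIV" "g holomorphic_on UNIV"
    using assms by (simp_all add: fock_space_def)
  have [measurable]: "f \<in> borel_measurable borel" "g \<in> borel_measurable borel"
    using hol by (simp_all add: holomorphic_borel_measurable)
  have "integrable fock_measure (\<lambda>z. (norm (f z + g z))\<^sup>2)"
  proof (rule Bochner_Integration.integrable_bound)
    show "integrable fock_measure (\<lambda>z. 2 * (norm (f z))\<^sup>2 + 2 * (norm (g z))\<^sup>2)"
      using assms by (simp add: fock_space_def)
    have "(norm (f z + g z))\<^sup>2 \<le> 2 * (norm (f z))\<^sup>2 + 2 * (norm (g z))\<^sup>2" for z
    proof -
      have "(norm (f z + g z))\<^sup>2 \<le> (norm (f z) + norm (g z))\<^sup>2"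
        by (intro power_mono norm_triangle_ineq) simp
      also have "\<dots> \<le> 2 * (norm (f z))\<^sup>2 + 2 * (norm (g z))\<^sup>2"
        using zero_le_power2[of "norm (f z) - norm (g z)"] by (simp add: power2_eq_square algebra_simps)
      finally show ?thesis .
    qed
    then show "AE z in fock_measure. norm ((norm (f z + g z))\<^sup>2) \<le>
        norm (2 * (norm (f z))\<^sup>2 + 2 * (norm (g z))\<^sup>2)"
      by simp
  qed simp
  then show ?thesis
    using hol by (simp add: fock_space_def holomorphic_on_add)
qed

text \<open>The test vectors lie in the span of two monomials, so this evaluates both their norms
  and the quadratic form. Conjugates appear because the inner product is antilinear in its second
  argument.\<close>

lemma fock_inner_binomial:
  assumes f: "f \<in> fock_space" and c: "\<And>z. (\<lambda>j. c j * z ^ j) sums f z"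
  shows "fock_inner f (\<lambda>z. A * z ^ k + B * z ^ l) =
    cnj A * c k * fact k + cnj B * c l * fact l"
proof -
  have scale: "(\<integral>z. f z * cnj (C * z ^ i) \<partial>fock_measure) = cnj C * c i * fact i" for C i
  proof -
    have "(\<integral>z. f z * cnj (C * z ^ i) \<partial>fock_measure) = (\<integral>z. cnj C * (f z * cnj (z ^ i)) \<partial>fock_measure)"
      by (rule Bochner_Integration.integral_cong) (simp_all add: mult_ac)
    also have "\<dots> = cnj C * fock_inner f (\<lambda>z. z ^ i)"
      unfolding fock_inner_def by (rule integral_mult_right_zero)
    finally show ?thesis by (simp add: fock_inner_power[OF f c])
  qed
  have "fock_inner f (\<lambda>z. A * z ^ k + B * z ^ l) =
      (\<integral>z. f z * cnj (A * z ^ k) + f z * cnj (B * z ^ l) \<partial>fock_measure)"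
    by (simp only: fock_inner_def complex_cnj_add distrib_left)
  also have "\<dots> = (\<integral>z. f z * cnj (A * z ^ k) \<partial>fock_measure) + (\<integral>z. f z * cnj (B * z ^ l) \<partial>fock_measure)"
    by (intro Bochner_Integration.integral_add integrable_fock_inner f power_in_fock_space)
  finally show ?thesis by (simp only: scale)
qed

section \<open>Weyl operators\<close>

text \<open>The constant |p|^2 / 2 makes the operator isometric; applied to the constant 1 it gives
  the normalised reproducing kernel at \<open>p\<close>.\<close>

definition weyl :: "complex \<Rightarrow> (complex \<Rightarrow> complex) \<Rightarrow> complex \<Rightarrow> complex" where
  "weyl p g = (\<lambda>z. exp (cnj p * z - of_real ((norm p)\<^sup>2 / 2)) * g (z - p))"

text \<open>The squared modulus of the exponential factor of \<open>weyl\<close>, which is also the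
  ratio of the Gaussian density at z - p to that at z.\<close>

definition weyl_weight :: "complex \<Rightarrow> complex \<Rightarrow> real" where
  "weyl_weight p z = exp (2 * Re (cnj p * z) - (norm p)\<^sup>2)"

lemma weyl_weight_measurable [measurable]: "weyl_weight p \<in> borel_measurable borel"
  unfolding weyl_weight_def by (intro borel_measurable_continuous_onI continuous_intros)

lemma norm_weyl_power2: "(norm (weyl p g z))\<^sup>2 = weyl_weight p z * (norm (g (z - p)))\<^sup>2"
  by (simp add: weyl_def weyl_weight_def norm_mult power_mult_distrib flip: exp_of_nat_mult)

lemma weyl_mult_cnj_weyl:
  "weyl p f z * cnj (weyl p g z) = weyl_weight p z *\<^sub>R (f (z - p) * cnj (g (z - p)))"
proof -
  define c where "c = cnj p * z - of_real ((norm p)\<^sup>2 / 2)"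
  have "exp c * cnj (exp c) = of_real (weyl_weight p z)"
    by (simp add: complex_norm_square[symmetric] c_def weyl_weight_def flip: exp_of_nat_mult of_real_power)
  then show ?thesis
    unfolding weyl_def c_def[symmetric] scaleR_conv_of_real by (metis complex_cnj_mult mult.assoc mult.left_commute)
qed

text \<open>The weight moves the centre of the Gaussian from 0 to \<open>p\<close>, as completing
  the square shows; the translation moves it back.\<close>

lemma distr_weyl_weight:
  "distr (density fock_measure (\<lambda>z. ennreal (weyl_weight p z))) borel (\<lambda>z. z - p) = fock_measure"
proof (rule measure_eqI)
  fix A assume "A \<in> sets (distr (density fock_measure (\<lambda>z. ennreal (weyl_weight p z))) borel (\<lambda>z. z - p))"
  then have A[measurable]: "A \<in> sets borel" by simp
  define G :: "complex \<Rightarrow> ennreal" where "G = (\<lambda>z. ennreal (exp (- (norm z)\<^sup>2) / pi) * indicator A z)"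
  have [measurable]: "G \<in> borel_measurable borel" by (simp add: G_def)
  have "emeasure (distr (density fock_measure (\<lambda>z. ennreal (weyl_weight p z))) borel (\<lambda>z. z - p)) A =
      (\<integral>\<^sup>+z. indicator A z \<partial>distr (density fock_measure (\<lambda>z. ennreal (weyl_weight p z))) borel (\<lambda>z. z - p))"
    by simp
  also have "\<dots> = (\<integral>\<^sup>+z. ennreal (weyl_weight p z) * indicator A (z - p) \<partial>fock_measure)"
    by (subst nn_integral_distr, simp_all, subst nn_integral_density) simp_all
  also have "\<dots> = (\<integral>\<^sup>+z. G (- p + z) \<partial>lborel)"
  proof (subst nn_integral_fock_measure)
    have "ennreal (exp (- (norm z)\<^sup>2) / pi) * (ennreal (weyl_weight p z) * indicator A (z - p)) = G (- p + z)" for z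
    proof -
      have "(norm (z - p))\<^sup>2 = (norm z)\<^sup>2 - (2 * Re (cnj p * z) - (norm p)\<^sup>2)"
        unfolding cmod_power2 by (simp add: power2_eq_square algebra_simps)
      then have "exp (- (norm z)\<^sup>2) / pi * weyl_weight p z = exp (- (norm (z - p))\<^sup>2) / pi"
        by (simp add: weyl_weight_def flip: exp_add)
      then show ?thesis
        by (simp add: G_def mult.assoc[symmetric] ennreal_mult'[symmetric] weyl_weight_def)
    qed
    then show "(\<integral>\<^sup>+z. ennreal (exp (- (norm z)\<^sup>2) / pi) * (ennreal (weyl_weight p z) * indicator A (z - p)) \<partial>lborel) =
        (\<integral>\<^sup>+z. G (- p + z) \<partial>lborel)" by simp
  qed simp
  also have "\<dots> = (\<integral>\<^sup>+z. indicator A z \<partial>fock_measure)"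
    by (subst nn_integral_lborel_translate, simp, subst nn_integral_fock_measure) (simp_all add: G_def)
  also have "\<dots> = emeasure fock_measure A" by simp
  finally show "emeasure (distr (density fock_measure (\<lambda>z. ennreal (weyl_weight p z))) borel (\<lambda>z. z - p)) A =
      emeasure fock_measure A" .
qed simp

text \<open>The change of variables behind the Weyl operators. The codomain is general so that it
  covers both the real function |g|^2 and the complex product of f with the conjugate of g.\<close>

lemma
  fixes F :: "complex \<Rightarrow> 'a::{banach, second_countable_topology}"
  assumes [measurable]: "F \<in> borel_measurable borel"
  shows integrable_weyl_weight_iff:
      "integrable fock_measure (\<lambda>z. weyl_weight p z *\<^sub>R F (z - p)) \<longleftrightarrow> integrable fock_measure F"
    and integral_weyl_weight:
      "(\<integral>z. weyl_weight p z *\<^sub>R F (z - p) \<partial>fock_measure) = (\<integral>z. F z \<partial>fock_measure)"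
proof -
  have nn: "AE z in fock_measure. 0 \<le> weyl_weight p z" by (simp add: weyl_weight_def)
  have m: "weyl_weight p \<in> borel_measurable fock_measure" by simp
  have F: "(\<lambda>z. F (z - p)) \<in> borel_measurable fock_measure" by simp
  show "integrable fock_measure (\<lambda>z. weyl_weight p z *\<^sub>R F (z - p)) \<longleftrightarrow> integrable fock_measure F"
    unfolding integrable_density[OF F m nn, symmetric]
    by (subst (2) distr_weyl_weight[of p, symmetric], subst integrable_distr_eq) simp_all
  show "(\<integral>z. weyl_weight p z *\<^sub>R F (z - p) \<partial>fock_measure) = (\<integral>z. F z \<partial>fock_measure)"
    unfolding integral_density[OF F m nn, symmetric]
    by (subst (2) distr_weyl_weight[of p, symmetric], subst integral_distr) simp_all
qed

text \<open>Both directions serve the main proof: test functions are carried forward, and their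
  images under the operator are carried back.\<close>

lemma weyl_in_fock_space_iff:
  assumes "g holomorphic_on UNIV"
  shows "weyl p g \<in> fock_space \<longleftrightarrow> g \<in> fock_space"
proof -
  have [measurable]: "g \<in> borel_measurable borel"
    using assms by (rule holomorphic_borel_measurable)
  have "(\<lambda>z. g (z - p)) holomorphic_on UNIV"
    using holomorphic_on_compose_gen[OF _ assms, of "\<lambda>z. z - p" UNIV]
    by (simp add: o_def holomorphic_intros)
  then have "weyl p g holomorphic_on UNIV"
    unfolding weyl_def by (intro holomorphic_intros)
  then show ?thesis
    using assms integrable_weyl_weight_iff[of "\<lambda>z. (norm (g z))\<^sup>2" p]
    by (simp add: fock_space_def norm_weyl_power2)
qed

lemma fock_inner_weyl:
  assumes "f \<in> fock_space" "g \<in> fock_space"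
  shows "fock_inner (weyl p f) (weyl p g) = fock_inner f g"
proof -
  have "(\<lambda>z. f z * cnj (g z)) \<in> borel_measurable borel"
    using borel_measurable_integrable[OF integrable_fock_inner[OF assms]] by simp
  then show ?thesis
    unfolding fock_inner_def weyl_mult_cnj_weyl by (rule integral_weyl_weight)
qed

lemma fock_norm_weyl: "g \<in> fock_space \<Longrightarrow> fock_norm (weyl p g) = fock_norm g"
  by (simp add: fock_norm_def fock_inner_weyl)

section \<open>The numerical range\<close>

text \<open>Multiplication by z^n shifts coefficients; the test \<open>j < n\<close> guards the
  truncated subtraction.\<close>

lemma sums_power_mult:
  fixes z :: "'a::real_normed_field"
  assumes "(\<lambda>j. c j * z ^ j) sums s"
  shows "(\<lambda>j. (if j < n then 0 else c (j - n)) * z ^ j) sums (z ^ n * s)"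
proof (subst sums_zero_iff_shift[where n = n, symmetric])
  have "(\<lambda>j. z ^ n * (c j * z ^ j)) sums (z ^ n * s)"
    using assms by (rule sums_mult)
  then show "(\<lambda>i. (if i + n < n then 0 else c (i + n - n)) * z ^ (i + n)) sums (z ^ n * s)"
    by (simp add: power_add mult_ac)
qed simp

text \<open>The pair (cos t, sin t) has product sin(2t) / 2, which takes every value from 0 to 1/2;
  the phase of \<open>v\<close> is put into the second entry.\<close>

lemma exists_unit_pair_mult_cnj:
  fixes v :: complex
  assumes "norm v \<le> 1 / 2"
  obtains \<alpha> \<beta> :: complex where "(norm \<alpha>)\<^sup>2 + (norm \<beta>)\<^sup>2 = 1" "\<alpha> * cnj \<beta> = v"
proof
  define t where "t = arcsin (2 * norm v) / 2"
  define \<beta> where "\<beta> = cnj (sgn v) * of_real (sin t)"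
  have dbl: "cos t * sin t = norm v"
  proof -
    have "sin (2 * t) = 2 * norm v"
      using assms norm_ge_zero[of v] unfolding t_def by (simp del: norm_ge_zero add: sin_arcsin)
    then show ?thesis unfolding sin_double by (simp add: mult.commute)
  qed
  show "of_real (cos t) * cnj \<beta> = v"
  proof -
    have "of_real (cos t) * cnj \<beta> = of_real (cos t * sin t) * sgn v"
      by (simp add: \<beta>_def)
    also have "\<dots> = v" unfolding dbl by (simp add: sgn_eq)
    finally show ?thesis .
  qed
  show "(norm (of_real (cos t) :: complex))\<^sup>2 + (norm \<beta>)\<^sup>2 = 1"
    \<comment> \<open>For \<open>v = 0\<close> the sign is 0 and not unimodular, but then t = 0 and
      the pair is (1, 0).\<close>
    by (cases "v = 0") (simp_all add: \<beta>_def norm_mult norm_sgn power_mult_distrib t_def)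
qed

theorem theorem2p3:
  fixes \<psi> \<phi> q :: "complex \<Rightarrow> complex"
    and a b p :: complex
    and qhat :: "nat \<Rightarrow> complex"
    and n m :: nat
  assumes "\<psi> holomorphic_on UNIV"
    and "0 < norm a" and "norm a < 1"
    and "\<phi> = (\<lambda>z. a * z + b)"
    and "m > 0"
    and "fock_bounded (weighted_comp \<psi> \<phi>)"
    and "p = b / (1 - a)"
    and "\<psi> p = 0"
    and "q = (\<lambda>z. exp (cnj p * (a - 1) * z) * \<psi> (z + p))"
    and "\<And>z. (\<lambda>j. qhat j * (z ^ j / of_real (sqrt (fact j)))) sums q z"
  shows "q \<in> fock_space \<and>
    cball 0 (1 / 2 * norm (qhat m * a ^ n *
        of_real (sqrt (fact (n + m)) / sqrt (fact m * fact n))))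
      \<subseteq> numerical_range (weighted_comp \<psi> \<phi>)"
proof -
  let ?C = "weighted_comp \<psi> \<phi>"
  \<comment> \<open>Around its fixed point the affine map is multiplication by \<open>a\<close>.
    Here 1 - a is nonzero because |a| < 1.\<close>
  have ap: "a * z + b - p = a * (z - p)" for z
  proof -
    have "b = (1 - a) * p" using assms(3,7) by auto
    then show ?thesis by (simp add: algebra_simps)
  qed
  \<comment> \<open>The Weyl exponent at a z + b is the one at z plus cnj(p) (a - 1) (z - p), and
    the exponential of this surplus is the factor built into \<open>q\<close> at z - p.\<close>
  have intertwine: "?C (weyl p g) = weyl p (\<lambda>z. q z * g (a * z))" for g
  proof
    fix z
    have "cnj p * (a * z + b) = cnj p * z + cnj p * (a - 1) * (z - p)"
    proof -
      have "a * z + b = z + (a - 1) * (z - p)"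
        using ap[of z] by (simp add: algebra_simps)
      then show ?thesis by (simp only: distrib_left mult.assoc)
    qed
    then have "cnj p * (a * z + b) - of_real ((norm p)\<^sup>2 / 2) =
        (cnj p * z - of_real ((norm p)\<^sup>2 / 2)) + cnj p * (a - 1) * (z - p)"
      by simp
    then have "exp (cnj p * (a * z + b) - of_real ((norm p)\<^sup>2 / 2)) =
        exp (cnj p * z - of_real ((norm p)\<^sup>2 / 2)) * exp (cnj p * (a - 1) * (z - p))"
      by (simp only: exp_add)
    then show "?C (weyl p g) z = weyl p (\<lambda>z. q z * g (a * z)) z"
      by (simp add: weighted_comp_def weyl_def assms(4,9) ap)
  qed
  have q_hol: "q holomorphic_on UNIV"
  proof -
    have "(\<lambda>z. \<psi> (z + p)) holomorphic_on UNIV"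
      using holomorphic_on_compose_gen[OF _ assms(1), of "\<lambda>z. z + p" UNIV]
      by (simp add: o_def holomorphic_intros)
    then show ?thesis unfolding assms(9) by (intro holomorphic_intros)
  qed
  \<comment> \<open>The product is in the space because its Weyl transform is the image of
    \<open>weyl p g\<close> under the bounded operator.\<close>
  have model: "(\<lambda>z. q z * g (a * z)) \<in> fock_space" if g: "g \<in> fock_space" for g
  proof -
    have g_hol: "g holomorphic_on UNIV" using g by (simp add: fock_space_def)
    have "(\<lambda>z. g (a * z)) holomorphic_on UNIV"
      using holomorphic_on_compose_gen[OF _ g_hol, of "\<lambda>z. a * z" UNIV]
      by (simp add: o_def holomorphic_intros)
    then have hol: "(\<lambda>z. q z * g (a * z)) holomorphic_on UNIV"
      using q_hol by (intro holomorphic_intros)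
    have "weyl p g \<in> fock_space" using g g_hol by (simp add: weyl_in_fock_space_iff)
    then have "?C (weyl p g) \<in> fock_space" using assms(6) by (simp add: fock_bounded_def)
    then show ?thesis using hol by (simp add: intertwine weyl_in_fock_space_iff)
  qed
  have range: "fock_inner (\<lambda>z. q z * g (a * z)) g \<in> numerical_range ?C"
    if g: "g \<in> fock_space" "fock_norm g = 1" for g
  proof -
    have "g holomorphic_on UNIV" using g by (simp add: fock_space_def)
    then have "weyl p g \<in> fock_space" using g by (simp add: weyl_in_fock_space_iff)
    moreover have "fock_norm (weyl p g) = 1" using g by (simp add: fock_norm_weyl)
    moreover have "fock_inner (?C (weyl p g)) (weyl p g) = fock_inner (\<lambda>z. q z * g (a * z)) g"
      using g by (simp add: intertwine fock_inner_weyl model)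
    ultimately show ?thesis unfolding numerical_range_def by force
  qed
  \<comment> \<open>\<open>q\<close> is the image of the constant function 1 under the model
    operator.\<close>
  have "q \<in> fock_space"
    using model[of "\<lambda>z. 1"] power_in_fock_space[of 1 0] by simp
  define r where "r = (\<lambda>k. complex_of_real (sqrt (fact k)))"
  have r_sq: "r k * r k = fact k" for k
    by (simp add: r_def flip: of_real_mult)
  have r_nz: "r k \<noteq> 0" for k by (simp add: r_def)
  have cnj_r: "cnj (r k) = r k" for k by (simp add: r_def)
  define Q where "Q = (\<lambda>j. qhat j / r j)"
  have Q: "(\<lambda>j. Q j * z ^ j) sums q z" for z
    using assms(10)[of z] by (simp add: Q_def r_def)
  \<comment> \<open>This is where psi(p) = 0 enters; it makes the diagonal of the compression
    vanish.\<close>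
  have Q0: "Q 0 = 0"
    using Q[of 0] by (simp add: powser_sums_zero_iff assms(8,9))
  \<comment> \<open>\<open>c\<close> is the matrix entry <T e_n, e_(n+m)> of the model operator T,
    which sends g to q(z) g(a z).\<close>
  define c where "c = qhat m * a ^ n * of_real (sqrt (fact (n + m)) / sqrt (fact m * fact n))"
  have c: "c = Q m * a ^ n * r (n + m) / r n"
    by (simp add: c_def Q_def r_def real_sqrt_mult)
  have attained: "\<alpha> * cnj \<beta> * c \<in> numerical_range ?C"
    if ab: "(norm \<alpha>)\<^sup>2 + (norm \<beta>)\<^sup>2 = 1" for \<alpha> \<beta>
  proof -
    define A where "A = \<alpha> / r n"
    define B where "B = \<beta> / r (n + m)"
    define g where "g = (\<lambda>z. A * z ^ n + B * z ^ (n + m))"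
    have g: "g \<in> fock_space"
      unfolding g_def by (intro fock_space_add power_in_fock_space)
    \<comment> \<open>Writing \<open>g\<close> as a power series lets
      \<open>fock_inner_binomial\<close> compute its norm; \<open>m > 0\<close> keeps the two
      exponents apart.\<close>
    have "(\<lambda>j. ((if j = n then A else 0) + (if j = n + m then B else 0)) * z ^ j) sums g z" for z
    proof -
      have "(\<lambda>j. (if j = k then D else 0) * z ^ j) sums (D * z ^ k)" for D k
        using sums_single[of k "\<lambda>j. D * z ^ j"] by (simp add: if_distrib[of "\<lambda>x. x * _"] cong: if_cong)
      then show ?thesis unfolding g_def distrib_right by (intro sums_add)
    qed
    from fock_inner_binomial[OF g this, of A n B "n + m"]
    have "fock_inner g g = cnj A * A * (r n * r n) + cnj B * B * (r (n + m) * r (n + m))"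
      using \<open>m > 0\<close> by (simp add: g_def r_sq)
    also have "\<dots> = \<alpha> * cnj \<alpha> + \<beta> * cnj \<beta>"
      using r_nz by (simp add: A_def B_def cnj_r)
    also have "\<dots> = of_real ((norm \<alpha>)\<^sup>2 + (norm \<beta>)\<^sup>2)"
      by (simp only: complex_norm_square of_real_add)
    finally have "fock_norm g = 1" by (simp only: fock_norm_def ab) simp
    \<comment> \<open>Taylor coefficients of q(z) g(a z): each monomial of g(a z) contributes a
      shifted and scaled copy of \<open>Q\<close>.\<close>
    define d where "d = (\<lambda>j. A * a ^ n * (if j < n then 0 else Q (j - n)) +
        B * a ^ (n + m) * (if j < n + m then 0 else Q (j - (n + m))))"
    have d: "(\<lambda>j. d j * z ^ j) sums (q z * g (a * z))" for z
    proof -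
      have "(\<lambda>j. D * ((if j < k then 0 else Q (j - k)) * z ^ j)) sums (D * (z ^ k * q z))" for D k
        by (intro sums_mult sums_power_mult Q)
      from sums_add[OF this[of "A * a ^ n" n] this[of "B * a ^ (n + m)" "n + m"]]
      show ?thesis
        by (simp only: d_def g_def distrib_left distrib_right power_mult_distrib mult_ac)
    qed
    \<comment> \<open>At index n the first copy gives \<open>Q 0\<close> and the second has not
      started. At n + m the first gives \<open>Q m\<close> and the second
      \<open>Q 0\<close>.\<close>
    have "d n = 0" "d (n + m) = A * a ^ n * Q m"
      using \<open>m > 0\<close> by (simp_all add: d_def Q0)
    with fock_inner_binomial[OF model[OF g] d, of A n B "n + m"]
    have "fock_inner (\<lambda>z. q z * g (a * z)) g = cnj B * (A * a ^ n * Q m) * (r (n + m) * r (n + m))"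
      by (simp add: g_def r_sq)
    also have "\<dots> = \<alpha> * cnj \<beta> * c"
      using r_nz by (simp add: A_def B_def c cnj_r)
    finally show ?thesis using range[OF g \<open>fock_norm g = 1\<close>] by simp
  qed
  have "w \<in> numerical_range ?C" if w: "norm w \<le> 1 / 2 * norm c" for w
  proof (cases "c = 0")
    case True
    \<comment> \<open>The disk is just the origin, the value at the vector e_n.\<close>
    then show ?thesis using w attained[of 1 0] by simp
  next
    case False
    then have "norm (w / c) \<le> 1 / 2"
      using w by (simp add: norm_divide field_simps)
    then obtain \<alpha> \<beta> where "(norm \<alpha>)\<^sup>2 + (norm \<beta>)\<^sup>2 = 1" "\<alpha> * cnj \<beta> = w / c"
      by (rule exists_unit_pair_mult_cnj)
    with attained[of \<alpha> \<beta>] False show ?thesis by simp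
  qed
  then have "cball 0 (1 / 2 * norm c) \<subseteq> numerical_range ?C" by auto
  with \<open>q \<in> fock_space\<close> show ?thesis by (simp only: c_def)
qed

end
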